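(* Let $X$ be a Tychonoff space and let $\mathscr{P}$ be an ideal of closed sets in $X$ with $|X_\mathscr{P}|\geq 3$. Then: (i) the center of $G(C_\mathscr{P}(X))$ is all of $V(C_\mathscr{P}(X))$; (ii) $rad(G(C_\mathscr{P}(X)))=2=rad(AG(C_\mathscr{P}(X)))$.
   Context: $C(X)$ is the ring of all real valued continuous functions on the Tychonoff (completely regular Hausdorff) space $X$; $Z(f)=\{x\in X: f(x)=0\}$. An ideal of closed sets in $X$ is a nonempty family $\mathscr{P}$ of closed subsets of $X$ such that $A,B\in\mathscr{P}$ implies $A\cup B\in\mathscr{P}$, and $A\in\mathscr{P}$, $C\subset A$ with $C$ closed in $X$ implies $C\in\mathscr{P}$. $C_\mathscr{P}(X)=\{f\in C(X): cl_X(X\setminus Z(f))\in\mathscr{P}\}$, a commutative ring (possibly without identity). $X_\mathscr{P}$ is the set of all $x\in X$ having an open neighborhood $V$ with $cl_XV\in\mathscr{P}$. For a commutative ring $R$, $Z(R)^*$ is the set of nonzero zero divisors, i.e. nonzero $a\in R$ with $ab=0$ for some nonzero $b\in R$, and $ann(a)=\{r\in R: ra=0\}$. The annihilator graph $AG(R)$ is the simple graph with vertex set $Z(R)^*$ in which distinct $a,b$ are adjacent iff $ann(a)\cup ann(b)\neq ann(ab)$. On $C_\mathscr{P}(X)$ define the equivalence relation $f\sim g$ iff $int_XZ(f)\cap X_\mathscr{P}=int_XZ(g)\cap X_\mathscr{P}$. Fix a set $S\subset C_\mathscr{P}(X)$ containing exactly one element of each equivalence class, and put $V(C_\mathscr{P}(X))=\{f\in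 S\setminus\{0\}: int_XZ(f)\cap X_\mathscr{P}\neq\emptyset\}$, which is a subset of $Z(C_\mathscr{P}(X))^*$. $G(C_\mathscr{P}(X))$ is the induced subgraph of $AG(C_\mathscr{P}(X))$ with vertex set $V(C_\mathscr{P}(X))$. The eccentricity of a vertex $f$ of a graph $H$ is $ecc(f)=\max\{d_H(f,g): g \text{ a vertex of } H\}$. A vertex $f$ is in the center of $H$ if $ecc(f)\leq ecc(g)$ for every vertex $g$ of $H$, and in that case $ecc(f)$ is the radius $rad(H)$. *)

theory Defs
  imports
    "HOL-Analysis.Analysis"
    "HOL-Library.Function_Algebras"
    "Graph_Theory.Graph_Theory"
begin

subsection \<open>Distance, eccentricity, center and radius of a graph\<close>

text \<open>A simple graph is a symmetric loop-free digraph whose arcs are pairs of vertices; an edge is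
  represented by its two orientations. The distance is the infimum of the lengths of the walks
  joining two vertices, so it is infinite between different components.\<close>

definition gdist :: "'v pair_pre_digraph \<Rightarrow> 'v \<Rightarrow> 'v \<Rightarrow> ereal" where
  "gdist H u v = wf_digraph.\<mu> (with_proj H) (\<lambda>_. 1) u v"

lemma gdist_eq:
  fixes H :: "'v pair_pre_digraph"
  assumes "wf_digraph (with_proj H)"
  shows "gdist H u v = (INF p\<in>{p. pre_digraph.awalk (with_proj H) u p v}. ereal (real (length p)))"
proof -
  interpret wf_digraph "with_proj H" by fact
  have cost: "awalk_cost (\<lambda>_. 1) p = real (length p)" for p :: "('v \<times> 'v) awalk"
    by (induct p) simp_all
  show ?thesis
    unfolding gdist_def \<mu>_def cost ..
qed

text \<open>All distances lie in \<open>{0, 1, 2, \<dots>, \<infinity>}\<close>, so a finite supremum is attained and is a maximum.\<close>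

definition ecc :: "'v pair_pre_digraph \<Rightarrow> 'v \<Rightarrow> ereal" where
  "ecc H u = (SUP v\<in>pverts H. gdist H u v)"

definition center :: "'v pair_pre_digraph \<Rightarrow> 'v set" where
  "center H = {u \<in> pverts H. \<forall>v\<in>pverts H. ecc H u \<le> ecc H v}"

text \<open>The common eccentricity of the vertices in the center.\<close>

definition rad :: "'v pair_pre_digraph \<Rightarrow> ereal" where
  "rad H = (THE r. \<exists>u\<in>center H. r = ecc H u)"

definition induced :: "'v pair_pre_digraph \<Rightarrow> 'v set \<Rightarrow> 'v pair_pre_digraph" where
  "induced H W = \<lparr>pverts = W, parcs = {(u, v) \<in> parcs H. u \<in> W \<and> v \<in> W}\<rparr>"

lemma with_proj_induced: "with_proj (induced H W) = with_proj H \<restriction> W"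
  by (auto simp: induced_def with_proj_def induce_subgraph_def)

subsection \<open>The annihilator graph of a commutative ring\<close>

text \<open>A commutative ring, possibly without identity, is given as a subring \<open>R\<close> of an ambient
  commutative ring (again possibly without identity), whose operations it inherits.\<close>

definition zero_divisors :: "'r::comm_ring set \<Rightarrow> 'r set" where
  "zero_divisors R = {a \<in> R. a \<noteq> 0 \<and> (\<exists>b\<in>R. b \<noteq> 0 \<and> a * b = 0)}"

definition ann :: "'r::comm_ring set \<Rightarrow> 'r \<Rightarrow> 'r set" where
  "ann R a = {r \<in> R. r * a = 0}"

definition AG :: "'r::comm_ring set \<Rightarrow> 'r pair_pre_digraph" where
  "AG R = \<lparr>pverts = zero_divisors R,
           parcs = {(a, b). a \<in> zero_divisors R \<and> b \<in> zero_divisors R \<and> a \<noteq> b \<and>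
                            ann R a \<union> ann R b \<noteq> ann R (a * b)}\<rparr>"

lemma wf_AG: "pair_wf_digraph (AG R)"
  by unfold_locales (auto simp: AG_def)

lemma symmetric_AG: "symmetric (with_proj (AG R))"
  unfolding symmetric_def with_proj_simps AG_def sym_def
  by (simp add: Un_commute mult.commute) blast

subsection \<open>The ring of continuous functions with support in an ideal of closed sets\<close>

definition tychonoff_space :: "'a topology \<Rightarrow> bool" where
  "tychonoff_space X \<longleftrightarrow> completely_regular_space X \<and> Hausdorff_space X"

definition closed_ideal :: "'a topology \<Rightarrow> 'a set set \<Rightarrow> bool" where
  "closed_ideal X P \<longleftrightarrow>
     P \<noteq> {} \<and> (\<forall>A\<in>P. closedin X A) \<and>
     (\<forall>A\<in>P. \<forall>B\<in>P. A \<union> B \<in> P) \<and>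
     (\<forall>A\<in>P. \<forall>C. C \<subseteq> A \<and> closedin X C \<longrightarrow> C \<in> P)"

text \<open>Since HOL functions are total, a real function on \<open>topspace X\<close> is represented by its extension
  by zero. This makes equality of functions the equality on \<open>topspace X\<close>, and it is preserved by
  the pointwise ring operations on \<open>'a \<Rightarrow> real\<close>.\<close>

definition CX :: "'a topology \<Rightarrow> ('a \<Rightarrow> real) set" where
  "CX X = {f. continuous_map X euclideanreal f \<and> (\<forall>x. x \<notin> topspace X \<longrightarrow> f x = 0)}"

definition zero_set :: "'a topology \<Rightarrow> ('a \<Rightarrow> real) \<Rightarrow> 'a set" where
  "zero_set X f = {x \<in> topspace X. f x = 0}"

definition CP :: "'a topology \<Rightarrow> 'a set set \<Rightarrow> ('a \<Rightarrow> real) set" where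
  "CP X P = {f \<in> CX X. X closure_of (topspace X - zero_set X f) \<in> P}"

definition XP :: "'a topology \<Rightarrow> 'a set set \<Rightarrow> 'a set" where
  "XP X P = {x \<in> topspace X. \<exists>V. openin X V \<and> x \<in> V \<and> X closure_of V \<in> P}"

lemma CP_zero:
  assumes "closed_ideal X P"
  shows "0 \<in> CP X P"
proof -
  obtain A where "A \<in> P" using assms unfolding closed_ideal_def by (metis ex_in_conv)
  then have "{} \<in> P"
    using assms unfolding closed_ideal_def by (meson closedin_empty empty_subsetI)
  then show ?thesis by (simp add: CP_def CX_def zero_set_def zero_fun_def)
qed

lemma CP_support_subset:
  assumes "closed_ideal X P" "f \<in> CP X P" "g \<in> CP X P" "h \<in> CX X"
    and "topspace X - zero_set X h \<subseteq> (topspace X - zero_set X f) \<union> (topspace X - zero_set X g)"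
  shows "h \<in> CP X P"
proof -
  have "X closure_of (topspace X - zero_set X h) \<subseteq>
        X closure_of (topspace X - zero_set X f) \<union> X closure_of (topspace X - zero_set X g)"
    using closure_of_mono[OF assms(5)] by (simp add: closure_of_Un)
  moreover have "X closure_of (topspace X - zero_set X f) \<union> X closure_of (topspace X - zero_set X g) \<in> P"
    using assms(1-3) unfolding CP_def closed_ideal_def by blast
  ultimately have "X closure_of (topspace X - zero_set X h) \<in> P"
    using assms(1) by (meson closed_ideal_def closedin_closure_of)
  then show ?thesis using assms(4) by (simp add: CP_def)
qed

lemma CP_diff:
  assumes "closed_ideal X P" "f \<in> CP X P" "g \<in> CP X P"
  shows "f - g \<in> CP X P"
proof (rule CP_support_subset[OF assms])
  show "f - g \<in> CX X"
    using assms(2,3) by (simp add: CP_def CX_def fun_diff_def continuous_map_diff)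
qed (auto simp: zero_set_def)

lemma CP_mult:
  assumes "closed_ideal X P" "f \<in> CP X P" "g \<in> CP X P"
  shows "f * g \<in> CP X P"
proof (rule CP_support_subset[OF assms])
  show "f * g \<in> CX X"
    using assms(2,3) by (simp add: CP_def CX_def times_fun_def continuous_map_real_mult)
qed (auto simp: zero_set_def)

subsection \<open>The induced subgraph on representatives\<close>

definition CP_rel :: "'a topology \<Rightarrow> 'a set set \<Rightarrow> ('a \<Rightarrow> real) rel" where
  "CP_rel X P = {(f, g). f \<in> CP X P \<and> g \<in> CP X P \<and>
     X interior_of zero_set X f \<inter> XP X P = X interior_of zero_set X g \<inter> XP X P}"

lemma equiv_CP_rel: "equiv (CP X P) (CP_rel X P)"
  by (auto simp: equiv_def refl_on_def sym_def trans_def CP_rel_def)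

definition CP_representatives :: "'a topology \<Rightarrow> 'a set set \<Rightarrow> ('a \<Rightarrow> real) set \<Rightarrow> bool" where
  "CP_representatives X P S \<longleftrightarrow>
     S \<subseteq> CP X P \<and> (\<forall>c \<in> CP X P // CP_rel X P. \<exists>!f. f \<in> S \<inter> c)"

definition VCP :: "'a topology \<Rightarrow> 'a set set \<Rightarrow> ('a \<Rightarrow> real) set \<Rightarrow> ('a \<Rightarrow> real) set" where
  "VCP X P S = {f \<in> S - {0}. X interior_of zero_set X f \<inter> XP X P \<noteq> {}}"

definition GCP :: "'a topology \<Rightarrow> 'a set set \<Rightarrow> ('a \<Rightarrow> real) set \<Rightarrow> ('a \<Rightarrow> real) pair_pre_digraph" where
  "GCP X P S = induced (AG (CP X P)) (VCP X P S)"

end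

theory Submission
  imports Defs
begin

text \<open>
  Both graphs have eccentricity \<open>2\<close> at every vertex, and this settles all the claims at once.

  The ring \<open>R = CP X P\<close> is reduced, and in a reduced ring two zero divisors are adjacent in the
  annihilator graph exactly when neither annihilator contains the other (\<open>AG_arc_iff\<close>). Hence two
  nonadjacent zero divisors \<open>a\<close>, \<open>b\<close> have a nonzero common annihilator \<open>h\<close>. As \<open>h * a = 0\<close> forces
  the annihilators of \<open>h\<close> and \<open>a\<close> to be incomparable, \<open>h\<close> is adjacent to \<open>a\<close>, and likewise to \<open>b\<close>:
  all distances are at most \<open>2\<close>. A distance of exactly \<open>2\<close> from \<open>a\<close> is obtained from any zero divisor
  whose annihilator lies strictly above or strictly below that of \<open>a\<close>. Everything here depends
  on the vertices only through their annihilators, so it applies equally to \<open>AG R\<close> and to any induced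
  subgraph that meets each class of zero divisors with equal annihilators
  (\<open>center_rad_induced_AG\<close>).

  Topology enters through bump functions: every neighbourhood of a point of \<open>XP X P\<close> carries a
  function of \<open>R\<close> that does not vanish at the point (\<open>CP_bump\<close>). They show that the inclusion of
  annihilators is the inclusion of the sets \<open>X interior_of zero_set X f \<inter> XP X P\<close>
  (\<open>ann_CP_subset_iff\<close>), so the given equivalence relation identifies the functions with equal
  annihilators and \<open>VCP X P S\<close> consists of the zero divisors in \<open>S\<close>. They also provide the strictly
  comparable annihilators (\<open>CP_comparable_ann\<close>): the cozero set of a zero divisor can be shrunk if
  it has two points, and otherwise it can be enlarged because \<open>XP X P\<close> has three.
\<close>

section \<open>Graphs all of whose eccentricities are two\<close>

lemma gdist_le_awalk:
  assumes "pair_wf_digraph H" "pre_digraph.awalk (with_proj H) u p v"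
  shows "gdist H u v \<le> ereal (real (length p))"
proof -
  interpret pair_wf_digraph H by fact
  show ?thesis
    unfolding gdist_eq[OF wf_digraph_axioms] using assms(2) by (intro INF_lower) simp
qed

lemma gdist_le_2:
  assumes H: "pair_wf_digraph H" and u: "u \<in> pverts H"
    and "u = v \<or> (u, v) \<in> parcs H \<or> (\<exists>w. (u, w) \<in> parcs H \<and> (w, v) \<in> parcs H)"
  shows "gdist H u v \<le> 2"
proof -
  interpret pair_wf_digraph H by fact
  have "\<exists>p. awalk u p v \<and> length p \<le> 2"
    using assms(3)
  proof (elim disjE exE conjE)
    assume "u = v"
    then show ?thesis using u by (intro exI[of _ "[]"]) (simp add: awalk_Nil_iff)
  next
    assume "(u, v) \<in> parcs H"
    then show ?thesis
      by (intro exI[of _ "[(u, v)]"]) (auto simp: awalk_simps dest: in_arcsD2)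
  next
    fix w assume "(u, w) \<in> parcs H" "(w, v) \<in> parcs H"
    then show ?thesis
      by (intro exI[of _ "[(u, w), (w, v)]"]) (auto simp: awalk_simps dest: in_arcsD2)
  qed
  then obtain p where p: "awalk u p v" "length p \<le> 2" by blast
  have "gdist H u v \<le> ereal (real (length p))"
    using gdist_le_awalk[OF H p(1)] .
  also have "\<dots> \<le> 2" using p(2) by simp
  finally show ?thesis .
qed

lemma gdist_ge_2:
  assumes H: "pair_wf_digraph H" and "u \<noteq> v" "(u, v) \<notin> parcs H"
  shows "2 \<le> gdist H u v"
proof -
  interpret pair_wf_digraph H by fact
  have "2 \<le> length p" if "awalk u p v" for p
    using that assms(2,3) by (cases p rule: remdups_adj.cases) (auto simp: awalk_simps)
  then show ?thesis
    unfolding gdist_eq[OF wf_digraph_axioms] by (intro INF_greatest) auto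
qed

lemma ecc_eq_2:
  assumes "pair_wf_digraph H" "u \<in> pverts H"
    and "\<And>v. v \<in> pverts H \<Longrightarrow>
           u = v \<or> (u, v) \<in> parcs H \<or> (\<exists>w. (u, w) \<in> parcs H \<and> (w, v) \<in> parcs H)"
    and "v \<in> pverts H" "u \<noteq> v" "(u, v) \<notin> parcs H"
  shows "ecc H u = 2"
proof (rule antisym)
  show "ecc H u \<le> 2"
    unfolding ecc_def using assms(1-3) by (intro SUP_least gdist_le_2)
  show "2 \<le> ecc H u"
    unfolding ecc_def using assms by (intro SUP_upper2[of v] gdist_ge_2)
qed

lemma center_eq_pverts_if_ecc_const:
  assumes "\<And>u. u \<in> pverts H \<Longrightarrow> ecc H u = r"
  shows "center H = pverts H"
  using assms by (auto simp: center_def)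

lemma rad_eq_if_ecc_const:
  assumes "\<And>u. u \<in> pverts H \<Longrightarrow> ecc H u = r" "pverts H \<noteq> {}"
  shows "rad H = r"
proof -
  have "center H = pverts H" using assms(1) by (rule center_eq_pverts_if_ecc_const)
  then show ?thesis unfolding rad_def using assms by (intro the_equality) auto
qed

section \<open>Annihilator graphs of reduced rings\<close>

locale reduced_subring =
  fixes R :: "'r::comm_ring set"
  assumes zero_closed: "0 \<in> R"
    and diff_closed: "a \<in> R \<Longrightarrow> b \<in> R \<Longrightarrow> a - b \<in> R"
    and mult_closed: "a \<in> R \<Longrightarrow> b \<in> R \<Longrightarrow> a * b \<in> R"
    and square_eq_0: "a \<in> R \<Longrightarrow> a * a = 0 \<Longrightarrow> a = 0"
begin

lemma add_closed: "a \<in> R \<Longrightarrow> b \<in> R \<Longrightarrow> a + b \<in> R"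
  using diff_closed[of a "0 - b"] diff_closed[OF zero_closed, of b] by simp

lemma ann_commute: "a \<in> R \<Longrightarrow> b \<in> R \<Longrightarrow> a \<in> ann R b \<longleftrightarrow> b \<in> ann R a"
  by (simp add: ann_def mult.commute)

lemma self_in_ann_iff: "a \<in> R \<Longrightarrow> a \<in> ann R a \<longleftrightarrow> a = 0"
  using square_eq_0 by (auto simp: ann_def)

lemma zero_divisors_iff: "a \<in> zero_divisors R \<longleftrightarrow> a \<in> R \<and> a \<noteq> 0 \<and> (\<exists>h\<in>ann R a. h \<noteq> 0)"
  by (auto simp: zero_divisors_def ann_def mult.commute)

lemma zero_divisors_ann_cong:
  assumes "a \<in> zero_divisors R" "t \<in> R" "ann R t = ann R a"
  shows "t \<in> zero_divisors R"
proof -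
  have a: "a \<in> R" "a \<noteq> 0" using assms(1) by (simp_all add: zero_divisors_iff)
  \<comment> \<open>If \<open>t\<close> were zero, its annihilator would be \<open>R\<close>, which contains \<open>a\<close>.\<close>
  have "t \<noteq> 0"
  proof
    assume "t = 0"
    then have "a \<in> ann R t" using a(1) by (simp add: ann_def)
    then show False unfolding assms(3) self_in_ann_iff[OF a(1)] using a(2) by blast
  qed
  then show ?thesis using assms by (simp add: zero_divisors_iff)
qed

text \<open>If \<open>c\<close> annihilates \<open>a * b\<close>, then \<open>c * b\<close> annihilates \<open>a\<close>, hence also \<open>b\<close>, so \<open>c * b\<close> has square
  zero.\<close>

lemma ann_mult_eq:
  assumes "a \<in> R" "b \<in> R" "ann R a \<subseteq> ann R b"
  shows "ann R (a * b) = ann R b"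
proof
  show "ann R b \<subseteq> ann R (a * b)"
    by (auto simp: ann_def mult.left_commute[of _ a b])
  show "ann R (a * b) \<subseteq> ann R b"
  proof
    fix c assume "c \<in> ann R (a * b)"
    then have c: "c \<in> R" "c * (a * b) = 0" by (auto simp: ann_def)
    then have "c * b \<in> ann R a"
      using assms(2) mult_closed by (auto simp: ann_def mult_ac)
    then have "c * b * b = 0" using assms(3) by (auto simp: ann_def)
    then have "(c * b) * (c * b) = 0"
      by (metis mult.assoc mult.commute mult_zero_right)
    then have "c * b = 0" using square_eq_0 mult_closed c(1) assms(2) by blast
    then show "c \<in> ann R b" using c(1) by (simp add: ann_def)
  qed
qed

text \<open>For incomparable annihilators take \<open>c\<close> in the first only and \<open>d\<close> in the second only. Then
  \<open>c + d\<close> annihilates the product but neither factor. Conversely, if the annihilators are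
  comparable, reducedness makes the annihilator of the product the larger of the two.\<close>

lemma AG_arc_iff:
  assumes "a \<in> zero_divisors R" "b \<in> zero_divisors R"
  shows "(a, b) \<in> parcs (AG R) \<longleftrightarrow> \<not> ann R a \<subseteq> ann R b \<and> \<not> ann R b \<subseteq> ann R a"
proof
  have R: "a \<in> R" "b \<in> R" using assms by (simp_all add: zero_divisors_def)
  show "\<not> ann R a \<subseteq> ann R b \<and> \<not> ann R b \<subseteq> ann R a" if "(a, b) \<in> parcs (AG R)"
    using that ann_mult_eq[OF R] ann_mult_eq[OF R(2,1)] by (auto simp: AG_def mult.commute)
  assume inc: "\<not> ann R a \<subseteq> ann R b \<and> \<not> ann R b \<subseteq> ann R a"
  then obtain c d where c: "c \<in> R" "c * a = 0" "c * b \<noteq> 0" and d: "d \<in> R" "d * b = 0" "d * a \<noteq> 0"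
    by (auto simp: ann_def)
  have "(c + d) * (a * b) = (c * a) * b + (d * b) * a"
    by (simp add: algebra_simps)
  then have "c + d \<in> ann R (a * b)"
    using c d add_closed by (simp add: ann_def)
  moreover have "c + d \<notin> ann R a \<union> ann R b"
    using c d by (simp add: ann_def distrib_right)
  ultimately show "(a, b) \<in> parcs (AG R)"
    using inc assms by (auto simp: AG_def)
qed

text \<open>The annihilators are incomparable: neither of two orthogonal nonzero elements annihilates itself, but each annihilates the other.\<close>

lemma AG_arc_if_orthogonal:
  assumes "a \<in> zero_divisors R" "b \<in> zero_divisors R" "a \<in> ann R b"
  shows "(a, b) \<in> parcs (AG R)"
proof -
  have R: "a \<in> R" "a \<noteq> 0" "b \<in> R" "b \<noteq> 0" using assms by (auto simp: zero_divisors_def)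
  then have "a \<notin> ann R a" "b \<notin> ann R b" "b \<in> ann R a"
    using assms(3) self_in_ann_iff ann_commute by auto
  then show ?thesis using AG_arc_iff assms by blast
qed

lemma common_annihilator_if_not_AG_arc:
  assumes "a \<in> zero_divisors R" "b \<in> zero_divisors R" "(a, b) \<notin> parcs (AG R)"
  obtains h where "h \<in> zero_divisors R" "h \<in> ann R a" "h \<in> ann R b"
proof -
  have "ann R a \<subseteq> ann R b \<or> ann R b \<subseteq> ann R a"
    using AG_arc_iff assms by blast
  then obtain h where h: "h \<in> ann R a" "h \<in> ann R b" "h \<noteq> 0"
    using assms(1,2) by (auto simp: zero_divisors_iff)
  then have "h \<in> R" "a \<in> R" "a \<noteq> 0" using assms(1) by (auto simp: ann_def zero_divisors_def)
  then have "h \<in> zero_divisors R"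
    using h ann_commute by (auto simp: zero_divisors_iff)
  then show thesis using that h by blast
qed

lemma ecc_induced_AG:
  assumes T: "T \<subseteq> zero_divisors R"
    and meets: "\<And>a. a \<in> zero_divisors R \<Longrightarrow> \<exists>t\<in>T. ann R t = ann R a"
    and comparable: "\<And>a. a \<in> zero_divisors R \<Longrightarrow>
      \<exists>b\<in>zero_divisors R. ann R a \<subset> ann R b \<or> ann R b \<subset> ann R a"
    and a: "a \<in> T"
  shows "ecc (induced (AG R) T) a = 2"
proof -
  let ?H = "induced (AG R) T"
  have arc: "(u, v) \<in> parcs ?H \<longleftrightarrow> u \<in> T \<and> v \<in> T \<and> (u, v) \<in> parcs (AG R)" for u v
    by (auto simp: induced_def)
  have verts: "pverts ?H = T" by (simp add: induced_def)
  have wf: "pair_wf_digraph ?H"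
    by unfold_locales (auto simp: induced_def)
  have aZ: "a \<in> zero_divisors R" using a T by blast
  obtain b where "b \<in> zero_divisors R" "ann R a \<subset> ann R b \<or> ann R b \<subset> ann R a"
    using comparable[OF aZ] by blast
  then obtain t where t: "t \<in> T" "ann R a \<subset> ann R t \<or> ann R t \<subset> ann R a"
    using meets by metis
  then have far: "a \<noteq> t" "(a, t) \<notin> parcs ?H"
    using AG_arc_iff[OF aZ, of t] T arc by auto
  have near: "a = v \<or> (a, v) \<in> parcs ?H \<or> (\<exists>w. (a, w) \<in> parcs ?H \<and> (w, v) \<in> parcs ?H)"
    if v: "v \<in> T" for v
  proof (cases "(a, v) \<in> parcs (AG R)")
    case True
    then show ?thesis using a v arc by blast
  next
    case False
    have vZ: "v \<in> zero_divisors R" using v T by blast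
    obtain h where h: "h \<in> zero_divisors R" "h \<in> ann R a" "h \<in> ann R v"
      using common_annihilator_if_not_AG_arc[OF aZ vZ False] .
    \<comment> \<open>The common annihilator \<open>h\<close> may lie outside \<open>T\<close>; its representative annihilates the same
      elements.\<close>
    obtain w where w: "w \<in> T" "ann R w = ann R h" using meets[OF h(1)] by blast
    have wZ: "w \<in> zero_divisors R" using w T by blast
    have "h \<in> R" "a \<in> R" "v \<in> R" "w \<in> R"
      using h(1) aZ vZ wZ by (simp_all add: zero_divisors_def)
    then have "a \<in> ann R w" "w \<in> ann R v"
      using h w ann_commute by auto
    then show ?thesis using AG_arc_if_orthogonal aZ vZ wZ a v w(1) arc by blast
  qed
  show ?thesis
    using ecc_eq_2[OF wf, of a t] near far a t(1) unfolding verts by blast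
qed

lemma center_rad_induced_AG:
  assumes "T \<subseteq> zero_divisors R"
    and "\<And>a. a \<in> zero_divisors R \<Longrightarrow> \<exists>t\<in>T. ann R t = ann R a"
    and "\<And>a. a \<in> zero_divisors R \<Longrightarrow>
      \<exists>b\<in>zero_divisors R. ann R a \<subset> ann R b \<or> ann R b \<subset> ann R a"
    and "zero_divisors R \<noteq> {}"
  shows "center (induced (AG R) T) = T" "rad (induced (AG R) T) = 2"
proof -
  have verts: "pverts (induced (AG R) T) = T" by (simp add: induced_def)
  have ecc: "ecc (induced (AG R) T) a = 2" if "a \<in> pverts (induced (AG R) T)" for a
    using ecc_induced_AG[OF assms(1-3)] that unfolding verts by blast
  show "center (induced (AG R) T) = T"
    using center_eq_pverts_if_ecc_const[OF ecc] unfolding verts .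
  have "T \<noteq> {}" using assms(2,4) by blast
  then show "rad (induced (AG R) T) = 2"
    using rad_eq_if_ecc_const[OF ecc] unfolding verts by blast
qed

end

lemma induced_AG_zero_divisors: "induced (AG R) (zero_divisors R) = AG R"
  by (auto simp: induced_def AG_def)

section \<open>Annihilators of continuous functions\<close>

lemma reduced_subring_CP: "closed_ideal X P \<Longrightarrow> reduced_subring (CP X P)"
  by unfold_locales (auto simp: CP_zero CP_diff CP_mult fun_eq_iff)

lemma openin_cozero:
  assumes "f \<in> CX X"
  shows "openin X {x \<in> topspace X. f x \<noteq> 0}"
  using assms openin_continuous_map_preimage[of X euclideanreal f "- {0}"]
  by (simp add: CX_def open_Compl)

lemma cozero_eq_Diff_zero_set: "{x \<in> topspace X. f x \<noteq> 0} = topspace X - zero_set X f"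
  by (auto simp: zero_set_def)

lemma CP_imp_CX: "f \<in> CP X P \<Longrightarrow> f \<in> CX X"
  by (simp add: CP_def)

lemma nonzero_in_topspace: "f \<in> CP X P \<Longrightarrow> f x \<noteq> 0 \<Longrightarrow> x \<in> topspace X"
  by (auto simp: CP_def CX_def)

lemma openin_nonzero: "f \<in> CP X P \<Longrightarrow> openin X {x. f x \<noteq> 0}"
  using openin_cozero[OF CP_imp_CX, of f X P] nonzero_in_topspace[of f X P]
  by (metis (mono_tags, lifting) Collect_cong)

text \<open>The cozero set itself is a neighbourhood of each of its points with closure in \<open>P\<close>.\<close>

lemma nonzero_in_XP:
  assumes "f \<in> CP X P" "f x \<noteq> 0"
  shows "x \<in> XP X P"
proof -
  let ?V = "topspace X - zero_set X f"
  have "X closure_of ?V \<in> P" using assms(1) by (simp add: CP_def)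
  moreover have "openin X ?V"
    using openin_cozero[OF CP_imp_CX[OF assms(1)]] by (simp add: cozero_eq_Diff_zero_set)
  moreover have "x \<in> ?V" using assms nonzero_in_topspace by (fastforce simp: zero_set_def)
  ultimately show ?thesis unfolding XP_def by blast
qed

lemma openin_XP: "openin X (XP X P)"
proof (subst openin_subopen, intro ballI)
  fix x assume "x \<in> XP X P"
  then obtain V where V: "openin X V" "x \<in> V" "X closure_of V \<in> P" by (auto simp: XP_def)
  then have "V \<subseteq> XP X P" using openin_subset[OF V(1)] by (auto simp: XP_def)
  then show "\<exists>T. openin X T \<and> x \<in> T \<and> T \<subseteq> XP X P" using V by blast
qed

lemma CP_bump:
  assumes "completely_regular_space X" "closed_ideal X P" "openin X U" "x \<in> U" "x \<in> XP X P"
  obtains h where "h \<in> CP X P" "h x \<noteq> 0" "{y. h y \<noteq> 0} \<subseteq> U"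
proof -
  obtain V where V: "openin X V" "x \<in> V" "X closure_of V \<in> P"
    using assms(5) by (auto simp: XP_def)
  let ?W = "U \<inter> V"
  have W: "openin X ?W" using assms(3) V(1) by blast
  then have "closedin X (topspace X - ?W)" "x \<in> topspace X - (topspace X - ?W)"
    using assms(4) V(2) openin_subset by blast+
  then obtain f :: "'a \<Rightarrow> real" where f: "continuous_map X (top_of_set {0..1}) f" "f x = 0"
      "f ` (topspace X - ?W) \<subseteq> {1}"
    using assms(1) unfolding completely_regular_space_def by blast
  define h where "h = (\<lambda>y. if y \<in> topspace X then 1 - f y else 0)"
  have "continuous_map X euclideanreal (\<lambda>y. 1 - f y)"
    using f(1) by (intro continuous_map_diff) (auto simp: continuous_map_in_subtopology)
  then have "continuous_map X euclideanreal h"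
    by (rule continuous_map_eq) (simp add: h_def)
  then have hCX: "h \<in> CX X" by (simp add: CX_def h_def)
  have hW: "{y. h y \<noteq> 0} \<subseteq> ?W"
    using f(3) by (auto simp: h_def image_subset_iff split: if_splits)
  then have "X closure_of (topspace X - zero_set X h) \<subseteq> X closure_of V"
    by (intro closure_of_mono) (auto simp: zero_set_def)
  then have "X closure_of (topspace X - zero_set X h) \<in> P"
    using assms(2) V(3) by (meson closed_ideal_def closedin_closure_of)
  then have "h \<in> CP X P" using hCX by (simp add: CP_def)
  moreover have "h x \<noteq> 0"
    using f(2) assms(3,4) openin_subset by (fastforce simp: h_def)
  ultimately show thesis using that hW by blast
qed

lemma ann_CP_iff:
  "h \<in> ann (CP X P) f \<longleftrightarrow> h \<in> CP X P \<and> (\<forall>x. h x = 0 \<or> f x = 0)"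
  by (simp add: ann_def fun_eq_iff)

text \<open>If \<open>g\<close> does not vanish at some point of \<open>X interior_of zero_set X f \<inter> XP X P\<close>, then a bump at this
  point, supported in that open set, annihilates \<open>f\<close> but not \<open>g\<close>. Conversely, every function
  annihilating \<open>f\<close> vanishes off that set, hence annihilates each \<open>g\<close> that vanishes on it.\<close>

lemma ann_CP_subset_iff:
  assumes X: "completely_regular_space X" "closed_ideal X P" and f: "f \<in> CP X P"
  shows "ann (CP X P) f \<subseteq> ann (CP X P) g \<longleftrightarrow>
    X interior_of zero_set X f \<inter> XP X P \<subseteq> X interior_of zero_set X g \<inter> XP X P"
    (is "_ \<longleftrightarrow> ?F \<subseteq> ?G")
proof
  assume ann: "ann (CP X P) f \<subseteq> ann (CP X P) g"
  have F: "openin X ?F" by (simp add: openin_XP openin_Int)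
  have "g x = 0" if x: "x \<in> ?F" for x
  proof -
    obtain h where h: "h \<in> CP X P" "h x \<noteq> 0" "{y. h y \<noteq> 0} \<subseteq> ?F"
      using CP_bump[OF X F x] x by blast
    then have "h \<in> ann (CP X P) f"
      using interior_of_subset[of X "zero_set X f"] by (auto simp: ann_CP_iff zero_set_def)
    then have "h \<in> ann (CP X P) g" using ann by blast
    then show ?thesis using h(2) by (auto simp: ann_CP_iff)
  qed
  then have "?F \<subseteq> zero_set X g"
    using openin_subset[OF F] by (auto simp: zero_set_def)
  then show "?F \<subseteq> ?G" using F interior_of_maximal by blast
next
  assume FG: "?F \<subseteq> ?G"
  show "ann (CP X P) f \<subseteq> ann (CP X P) g"
  proof
    fix h assume "h \<in> ann (CP X P) f"
    then have h: "h \<in> CP X P" "\<And>x. h x = 0 \<or> f x = 0" by (auto simp: ann_CP_iff)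
    have "{x. h x \<noteq> 0} \<subseteq> zero_set X f"
      using h nonzero_in_topspace by (fastforce simp: zero_set_def)
    then have "{x. h x \<noteq> 0} \<subseteq> X interior_of zero_set X f"
      using openin_nonzero[OF h(1)] by (rule interior_of_maximal)
    then have "{x. h x \<noteq> 0} \<subseteq> ?G" using nonzero_in_XP[OF h(1)] FG by blast
    then have "h x = 0 \<or> g x = 0" for x
      using interior_of_subset[of X "zero_set X g"] by (auto simp: zero_set_def)
    then show "h \<in> ann (CP X P) g" using h(1) by (simp add: ann_CP_iff)
  qed
qed

lemma CP_rel_iff_ann_eq:
  assumes "completely_regular_space X" "closed_ideal X P"
  shows "(f, g) \<in> CP_rel X P \<longleftrightarrow>
    f \<in> CP X P \<and> g \<in> CP X P \<and> ann (CP X P) f = ann (CP X P) g"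
  using ann_CP_subset_iff[OF assms, of f g] ann_CP_subset_iff[OF assms, of g f]
  by (auto simp: CP_rel_def set_eq_subset)

text \<open>The cozero set of a nonzero function annihilating \<open>f\<close> is a nonempty open subset of both
  \<open>zero_set X f\<close> and \<open>XP X P\<close>. Conversely, a bump function supported in the interior of the zero set
  annihilates \<open>f\<close>.\<close>

lemma zero_divisors_CP_iff:
  assumes X: "completely_regular_space X" "closed_ideal X P"
  shows "f \<in> zero_divisors (CP X P) \<longleftrightarrow>
    f \<in> CP X P \<and> f \<noteq> 0 \<and> X interior_of zero_set X f \<inter> XP X P \<noteq> {}"
proof -
  interpret reduced_subring "CP X P" using X(2) by (rule reduced_subring_CP)
  let ?F = "X interior_of zero_set X f \<inter> XP X P"
  have "(\<exists>h\<in>ann (CP X P) f. h \<noteq> 0) \<longleftrightarrow> ?F \<noteq> {}"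
  proof
    assume "\<exists>h\<in>ann (CP X P) f. h \<noteq> 0"
    then obtain h x where h: "h \<in> CP X P" "\<And>y. h y = 0 \<or> f y = 0" "h x \<noteq> 0"
      by (auto simp: ann_CP_iff fun_eq_iff)
    have "{y. h y \<noteq> 0} \<subseteq> zero_set X f"
      using h nonzero_in_topspace by (fastforce simp: zero_set_def)
    then have "{y. h y \<noteq> 0} \<subseteq> X interior_of zero_set X f"
      using openin_nonzero[OF h(1)] by (rule interior_of_maximal)
    then show "?F \<noteq> {}" using nonzero_in_XP[OF h(1,3)] h(3) by blast
  next
    assume "?F \<noteq> {}"
    then obtain x where x: "x \<in> ?F" by blast
    obtain h where h: "h \<in> CP X P" "h x \<noteq> 0" "{y. h y \<noteq> 0} \<subseteq> X interior_of zero_set X f"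
      using CP_bump[OF X openin_interior_of, of x "zero_set X f"] x by blast
    then have "h \<in> ann (CP X P) f" "h \<noteq> 0"
      using interior_of_subset[of X "zero_set X f"] by (auto simp: ann_CP_iff zero_set_def)
    then show "\<exists>h\<in>ann (CP X P) f. h \<noteq> 0" by blast
  qed
  then show ?thesis by (simp add: zero_divisors_iff)
qed

text \<open>Two points of an open set are separated by bump functions supported in that set. All the
  orthogonal pairs needed below arise in this way.\<close>

lemma CP_disjoint_bumps:
  assumes "completely_regular_space X" "Hausdorff_space X" "closed_ideal X P"
    and U: "openin X U" and "x \<in> U" "y \<in> U" "x \<in> XP X P" "y \<in> XP X P" "x \<noteq> y"
  obtains h k where "h \<in> CP X P" "k \<in> CP X P" "h x \<noteq> 0" "k y \<noteq> 0"
    "\<forall>z. h z = 0 \<or> k z = 0" "\<forall>z. z \<notin> U \<longrightarrow> h z = 0 \<and> k z = 0"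
proof -
  have "x \<in> topspace X" "y \<in> topspace X" using assms by (auto simp: XP_def)
  then obtain A B where A: "openin X A" "x \<in> A" and B: "openin X B" "y \<in> B" and AB: "disjnt A B"
    using assms(2,9) unfolding Hausdorff_space_def by metis
  have AU: "openin X (A \<inter> U)" "x \<in> A \<inter> U" and BU: "openin X (B \<inter> U)" "y \<in> B \<inter> U"
    using A B U assms(5,6) by auto
  obtain h where h: "h \<in> CP X P" "h x \<noteq> 0" "{z. h z \<noteq> 0} \<subseteq> A \<inter> U"
    using CP_bump[OF assms(1,3) AU assms(7)] .
  obtain k where k: "k \<in> CP X P" "k y \<noteq> 0" "{z. k z \<noteq> 0} \<subseteq> B \<inter> U"
    using CP_bump[OF assms(1,3) BU assms(8)] .
  show thesis
  proof (rule that[OF h(1) k(1) h(2) k(2)])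
    show "\<forall>z. h z = 0 \<or> k z = 0" using h(3) k(3) AB by (auto simp: disjnt_def)
    show "\<forall>z. z \<notin> U \<longrightarrow> h z = 0 \<and> k z = 0" using h(3) k(3) by blast
  qed
qed

lemma zero_divisors_CP_nonempty:
  assumes "completely_regular_space X" "Hausdorff_space X" "closed_ideal X P"
    and "x \<in> XP X P" "y \<in> XP X P" "x \<noteq> y"
  shows "zero_divisors (CP X P) \<noteq> {}"
proof -
  obtain h k where "h \<in> CP X P" "k \<in> CP X P" "h x \<noteq> 0" "k y \<noteq> 0" "\<forall>z. h z = 0 \<or> k z = 0"
      "\<forall>z. z \<notin> XP X P \<longrightarrow> h z = 0 \<and> k z = 0"
    using CP_disjoint_bumps[OF assms(1-3) openin_XP assms(4,5,4,5,6)] .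
  then have "h \<in> CP X P" "k \<in> CP X P" "h \<noteq> 0" "k \<noteq> 0" "h * k = 0"
    by (auto simp: fun_eq_iff)
  then have "h \<in> zero_divisors (CP X P)"
    unfolding zero_divisors_def by blast
  then show ?thesis by blast
qed

lemma not_subset_pair:
  assumes "infinite A \<or> card A \<ge> 3"
  shows "\<not> A \<subseteq> {x, y}"
proof
  assume sub: "A \<subseteq> {x, y}"
  then have "finite A" by (rule finite_subset) simp
  moreover have "card A \<le> card {x, y}" using sub by (intro card_mono) simp_all
  moreover have "card {x, y} \<le> 2" by (cases "x = y") simp_all
  ultimately show False using assms by simp
qed

text \<open>If the cozero set of \<open>f\<close> contains two points, a bump at one of them, supported in the
  cozero set and vanishing at the other, has a strictly larger annihilator. Otherwise the cozero
  set is a single point, which is clopen; of the remaining points of \<open>XP X P\<close> one is used to enlarge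
  the cozero set and thus to shrink the annihilator, and the other to remain a zero divisor. This is
  where three points are required.\<close>

lemma CP_comparable_ann:
  assumes X: "completely_regular_space X" "Hausdorff_space X" "closed_ideal X P"
    and card: "infinite (XP X P) \<or> card (XP X P) \<ge> 3"
    and f: "f \<in> CP X P" "f \<noteq> 0"
  shows "\<exists>b\<in>zero_divisors (CP X P).
    ann (CP X P) f \<subset> ann (CP X P) b \<or> ann (CP X P) b \<subset> ann (CP X P) f"
proof -
  interpret reduced_subring "CP X P" using X(3) by (rule reduced_subring_CP)
  obtain x where x: "f x \<noteq> 0" using f(2) by (auto simp: fun_eq_iff)
  show ?thesis
  proof (cases "\<exists>y. y \<noteq> x \<and> f y \<noteq> 0")
    case True
    then obtain y where y: "x \<noteq> y" "f y \<noteq> 0" by metis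
    have fxy: "x \<in> {z. f z \<noteq> 0}" "y \<in> {z. f z \<noteq> 0}" using x y(2) by simp_all
    obtain h k where hR: "h \<in> CP X P" and kR: "k \<in> CP X P" and hx: "h x \<noteq> 0" and ky: "k y \<noteq> 0"
        and hk: "\<forall>z. h z = 0 \<or> k z = 0"
        and sub: "\<forall>z. z \<notin> {z. f z \<noteq> 0} \<longrightarrow> h z = 0 \<and> k z = 0"
      using CP_disjoint_bumps[OF X openin_nonzero[OF f(1)] fxy
          nonzero_in_XP[OF f(1) x] nonzero_in_XP[OF f(1) y(2)] y(1)] .
    have hf: "h z = 0" if "f z = 0" for z using sub that by simp
    have nz: "h \<noteq> 0" "k \<noteq> 0" using hx ky by auto
    have "k \<in> ann (CP X P) h" using kR hk by (simp add: ann_CP_iff disj_commute)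
    moreover have "k \<notin> ann (CP X P) f" using ky y(2) by (auto simp: ann_CP_iff)
    moreover have "ann (CP X P) f \<subseteq> ann (CP X P) h"
      using hf unfolding subset_iff ann_CP_iff by metis
    ultimately have "ann (CP X P) f \<subset> ann (CP X P) h" by blast
    moreover have "h \<in> zero_divisors (CP X P)"
      using hR nz \<open>k \<in> ann (CP X P) h\<close> by (auto simp: zero_divisors_iff)
    ultimately show ?thesis by blast
  next
    case False
    then have single: "f z = 0" if "z \<noteq> x" for z using that by blast
    obtain y where y: "y \<in> XP X P" "y \<noteq> x"
      using not_subset_pair[OF card, of x x] by blast
    obtain z where z: "z \<in> XP X P" "z \<noteq> x" "z \<noteq> y" using not_subset_pair[OF card, of x y] by blast
    have "closedin X {x}"
      using X(2) nonzero_in_topspace[OF f(1) x]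
      by (simp add: closedin_Hausdorff_singleton)
    then have U: "openin X (topspace X - {x})" by blast
    have yz: "y \<in> topspace X - {x}" "z \<in> topspace X - {x}" using y z by (auto simp: XP_def)
    obtain h k where hR: "h \<in> CP X P" and kR: "k \<in> CP X P" and hy: "h y \<noteq> 0" and kz: "k z \<noteq> 0"
        and hk: "\<forall>w. h w = 0 \<or> k w = 0"
        and sub: "\<forall>w. w \<notin> topspace X - {x} \<longrightarrow> h w = 0 \<and> k w = 0"
      using CP_disjoint_bumps[OF X U yz y(1) z(1) z(3)[symmetric]] .
    have h: "h \<in> CP X P" "h y \<noteq> 0" "h x = 0" and k: "k \<in> CP X P" "k z \<noteq> 0" "k x = 0"
      using hR hy kR kz sub by simp_all
    have nz: "(f + h) w = 0 \<longleftrightarrow> f w = 0 \<and> h w = 0" for w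
      using single[of w] h(3) by (cases "w = x") simp_all
    have "h \<in> ann (CP X P) f"
      using h(1,3) single unfolding ann_CP_iff by metis
    moreover have "h \<notin> ann (CP X P) (f + h)"
      using h(2) nz unfolding ann_CP_iff by metis
    moreover have "ann (CP X P) (f + h) \<subseteq> ann (CP X P) f"
      using nz unfolding subset_iff ann_CP_iff by metis
    ultimately have "ann (CP X P) (f + h) \<subset> ann (CP X P) f" by blast
    moreover have "f + h \<in> zero_divisors (CP X P)"
    proof -
      have "k w = 0 \<or> (f + h) w = 0" for w
        using single hk k(3) nz by metis
      then have "k \<in> ann (CP X P) (f + h)" using k(1) unfolding ann_CP_iff by blast
      moreover have "k \<noteq> 0" using k(2) by auto
      moreover have "f + h \<noteq> 0"
      proof
        assume "f + h = 0"
        then have "(f + h) x = 0" by simp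
        then show False using nz x by blast
      qed
      ultimately show ?thesis
        using add_closed[OF f(1) h(1)] unfolding zero_divisors_iff by blast
    qed
    ultimately show ?thesis by blast
  qed
qed

section \<open>The graph on representatives\<close>

lemma VCP_eq_zero_divisors:
  assumes "completely_regular_space X" "closed_ideal X P" "CP_representatives X P S"
  shows "VCP X P S = S \<inter> zero_divisors (CP X P)"
  using assms(3) zero_divisors_CP_iff[OF assms(1,2)]
  by (auto simp: VCP_def CP_representatives_def)

lemma VCP_meets_ann_classes:
  assumes "completely_regular_space X" "closed_ideal X P" "CP_representatives X P S"
    and f: "f \<in> zero_divisors (CP X P)"
  shows "\<exists>t\<in>VCP X P S. ann (CP X P) t = ann (CP X P) f"
proof -
  interpret reduced_subring "CP X P" using assms(2) by (rule reduced_subring_CP)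
  have "f \<in> CP X P" using f by (simp add: zero_divisors_def)
  then have "CP_rel X P `` {f} \<in> CP X P // CP_rel X P" by (rule quotientI)
  with assms(3) have "\<exists>!t. t \<in> S \<inter> CP_rel X P `` {f}"
    unfolding CP_representatives_def by (rule bspec[OF conjunct2])
  then obtain t where "t \<in> S" "(f, t) \<in> CP_rel X P"
    by (elim ex1E) auto
  then have t: "t \<in> S" "t \<in> CP X P" "ann (CP X P) t = ann (CP X P) f"
    using CP_rel_iff_ann_eq[OF assms(1,2)] by simp_all
  then have "t \<in> VCP X P S"
    using zero_divisors_ann_cong[OF f] VCP_eq_zero_divisors[OF assms(1-3)] by blast
  then show ?thesis using t(3) by blast
qed

theorem corollary4p9:
  fixes X :: "'a topology" and P :: "'a set set" and S :: "('a \<Rightarrow> real) set"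
  assumes "tychonoff_space X"
    and "closed_ideal X P"
    and "infinite (XP X P) \<or> card (XP X P) \<ge> 3"
    and "CP_representatives X P S"
  shows "center (GCP X P S) = VCP X P S \<and>
         rad (GCP X P S) = 2 \<and> rad (AG (CP X P)) = 2"
proof -
  interpret reduced_subring "CP X P" using assms(2) by (rule reduced_subring_CP)
  have X: "completely_regular_space X" "Hausdorff_space X"
    using assms(1) by (simp_all add: tychonoff_space_def)
  have comparable: "\<exists>b\<in>zero_divisors (CP X P).
      ann (CP X P) f \<subset> ann (CP X P) b \<or> ann (CP X P) b \<subset> ann (CP X P) f"
    if "f \<in> zero_divisors (CP X P)" for f
    using CP_comparable_ann[OF X assms(2,3)] that by (simp add: zero_divisors_def)
  obtain x where x: "x \<in> XP X P" using assms(3) by fastforce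
  obtain y where y: "y \<in> XP X P" "x \<noteq> y"
    using not_subset_pair[OF assms(3), of x x] by blast
  have nonempty: "zero_divisors (CP X P) \<noteq> {}"
    using zero_divisors_CP_nonempty[OF X assms(2) x y] .
  have "VCP X P S \<subseteq> zero_divisors (CP X P)"
    using VCP_eq_zero_divisors[OF X(1) assms(2,4)] by blast
  note G = center_rad_induced_AG[OF this VCP_meets_ann_classes[OF X(1) assms(2,4)]
      comparable nonempty]
  have "rad (induced (AG (CP X P)) (zero_divisors (CP X P))) = 2"
    using comparable nonempty by (intro center_rad_induced_AG) auto
  then show ?thesis
    using G by (simp add: GCP_def induced_AG_zero_divisors)
qed

end
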